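(* Let $\mathfrak n_{5,4}$ be the Lie algebra over $\mathbb F$ with ordered basis $\{x_1,x_2,x_3,x_4,x_5\}$ whose only nonzero brackets of basis elements (up to skew-symmetry) are $[x_4,x_3]=-x_1$, $[x_5,x_2]=-x_1$, and $[x_5,x_4]=-x_2$. Then for all $j,k,l,m,n,p,q,r,s,t\in\mathbb Z_{\ge0}$ the following identity holds in $\mathbf U(\mathfrak n_{5,4})$: $$\begin{aligned} &(x_1^jx_2^kx_3^lx_4^mx_5^n)(x_1^px_2^qx_3^rx_4^sx_5^t)\\ &=\sum_{\alpha=0}^{\min\{n,q\}}\ \sum_{\substack{\beta_1,\beta_2\in\mathbb Z_{\ge0}\\ \beta_1+\beta_2\leq s\\ \beta_1+2\beta_2\leq n-\alpha}}\ \sum_{\gamma=0}^{\min\{m,r\}}\binom{n}{\alpha}\binom{q}{\alpha}\binom{s}{\beta_1+\beta_2}\binom{n-\alpha}{\beta_1+2\beta_2}\binom{\beta_1+\beta_2}{\beta_1}\binom{m}{\gamma}\binom{r}{\gamma}\alpha!\,\frac{(\beta_1+2\beta_2)!}{2^{\beta_2}}\,\gamma!\\ &\quad\times (-1)^{\alpha+\beta_1+\gamma}\, x_1^{j+p+\alpha+\beta_2+\gamma}x_2^{k+q-\alpha+\beta_1}x_3^{l+r-\gamma}x_4^{m+s-\gamma-\beta_1-\beta_2}x_5^{n+t-\alpha-\beta_1-2\beta_2}. \end{aligned}$$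
   Context: $\mathbb F$ is $\mathbb R$ or $\mathbb C$. $\mathbf U(L)$ denotes the universal enveloping algebra of the Lie algebra $L$ (the universal unital associative $\mathbb F$-algebra with a linear map $\iota:L\to\mathbf U(L)$ satisfying $\iota([x,y])=\iota(x)\iota(y)-\iota(y)\iota(x)$). Elements of $L$ are identified with their images under $\iota$, so $xy=yx+[x,y]$ in $\mathbf U(L)$ for $x,y\in L$; powers and products of the $x_i$ are taken in $\mathbf U(L)$. *)

theory Defs
  imports "HOL-Analysis.Analysis" "HOL-Library.Poly_Mapping"
begin

section \<open>The ground field\<close>

text \<open>The fields isomorphic to \<open>\<real>\<close> or to \<open>\<complex>\<close>; both types are instances.\<close>

class real_or_complex = field_char_0 +
  assumes real_or_complex:
    "(\<exists>\<phi> :: 'a \<Rightarrow> real. bij \<phi> \<and>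
        (\<forall>x y. \<phi> (x + y) = \<phi> x + \<phi> y \<and> \<phi> (x * y) = \<phi> x * \<phi> y)) \<or>
     (\<exists>\<phi> :: 'a \<Rightarrow> complex. bij \<phi> \<and>
        (\<forall>x y. \<phi> (x + y) = \<phi> x + \<phi> y \<and> \<phi> (x * y) = \<phi> x * \<phi> y))"

instance real :: real_or_complex
  by intro_classes (intro disjI1 exI[of _ id], auto)

instance complex :: real_or_complex
  by intro_classes (intro disjI2 exI[of _ id], auto)


section \<open>Lie algebras and unital associative algebras\<close>

locale lie_algebra = vector_space scale
  for scale :: "'f::field \<Rightarrow> 'v::ab_group_add \<Rightarrow> 'v" +
  fixes bracket :: "'v \<Rightarrow> 'v \<Rightarrow> 'v"
  assumes bracket_add_left: "bracket (x + y) z = bracket x z + bracket y z"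
    and bracket_add_right: "bracket x (y + z) = bracket x y + bracket x z"
    and bracket_scale_left: "bracket (scale c x) y = scale c (bracket x y)"
    and bracket_scale_right: "bracket x (scale c y) = scale c (bracket x y)"
    and bracket_self: "bracket x x = 0"
    and jacobi: "bracket x (bracket y z) + bracket y (bracket z x) + bracket z (bracket x y) = 0"

locale assoc_algebra = vector_space scale
  for scale :: "'f::field \<Rightarrow> 'a::ring_1 \<Rightarrow> 'a" +
  assumes scale_mult_left: "scale c x * y = scale c (x * y)"
    and scale_mult_right: "x * scale c y = scale c (x * y)"

definition algebra_hom ::
  "('f::field \<Rightarrow> 'a::ring_1 \<Rightarrow> 'a) \<Rightarrow> ('f \<Rightarrow> 'b::ring_1 \<Rightarrow> 'b) \<Rightarrow> ('a \<Rightarrow> 'b) \<Rightarrow> bool"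
  where "algebra_hom sA sB h \<longleftrightarrow> Vector_Spaces.linear sA sB h \<and>
           h 1 = 1 \<and> (\<forall>x y. h (x * y) = h x * h y)"


section \<open>The universal enveloping algebra as a quotient of a free algebra\<close>

text \<open>
  The free unital associative algebra on the set of all elements of the Lie algebra is the monoid
  algebra of the free monoid. The monoid is written additively, because the convolution product of
  \<^theory>\<open>HOL-Library.Poly_Mapping\<close> is defined for additive monoids of exponents.
\<close>

datatype 'v free_word = Free_Word (letters: "'v list")

instantiation free_word :: (type) monoid_add
begin

definition "0 = Free_Word []"
definition "v + w = Free_Word (letters v @ letters w)"

instance
  by intro_classes (simp_all add: zero_free_word_def plus_free_word_def)

end

lemma letters_zero [simp]: "letters 0 = []"
  by (simp add: zero_free_word_def)

lemma letters_plus [simp]: "letters (v + w) = letters v @ letters w"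
  by (simp add: plus_free_word_def)

type_synonym ('v, 'f) free_algebra = "'v free_word \<Rightarrow>\<^sub>0 'f"

definition free_gen :: "'v \<Rightarrow> ('v, 'f::field) free_algebra"
  where "free_gen v = Poly_Mapping.single (Free_Word [v]) 1"

definition free_scale :: "'f::field \<Rightarrow> ('v, 'f) free_algebra \<Rightarrow> ('v, 'f) free_algebra"
  where "free_scale c p = Poly_Mapping.single 0 c * p"

inductive_set two_sided_ideal :: "'a::ring_1 set \<Rightarrow> 'a set" for S
  where
    zero: "0 \<in> two_sided_ideal S"
  | gen: "a \<in> S \<Longrightarrow> a \<in> two_sided_ideal S"
  | add: "a \<in> two_sided_ideal S \<Longrightarrow> b \<in> two_sided_ideal S \<Longrightarrow> a + b \<in> two_sided_ideal S"
  | mult_left: "a \<in> two_sided_ideal S \<Longrightarrow> r * a \<in> two_sided_ideal S"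
  | mult_right: "a \<in> two_sided_ideal S \<Longrightarrow> a * r \<in> two_sided_ideal S"

text \<open>The first two families of relators make \<open>\<iota>\<close> linear, the third makes it respect brackets.\<close>

definition uea_relators ::
  "('f::field \<Rightarrow> 'v::ab_group_add \<Rightarrow> 'v) \<Rightarrow> ('v \<Rightarrow> 'v \<Rightarrow> 'v) \<Rightarrow> ('v, 'f) free_algebra set"
  where "uea_relators sc br =
     {free_gen (x + y) - free_gen x - free_gen y | x y. True} \<union>
     {free_gen (sc c x) - free_scale c (free_gen x) | c x. True} \<union>
     {free_gen (br x y) - (free_gen x * free_gen y - free_gen y * free_gen x) | x y. True}"

definition uea_cong ::
  "('f::field \<Rightarrow> 'v::ab_group_add \<Rightarrow> 'v) \<Rightarrow> ('v \<Rightarrow> 'v \<Rightarrow> 'v) \<Rightarrow>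
   ('v, 'f) free_algebra \<Rightarrow> ('v, 'f) free_algebra \<Rightarrow> bool"
  where "uea_cong sc br p q \<longleftrightarrow> p - q \<in> two_sided_ideal (uea_relators sc br)"

lemma ideal_uminus: "a \<in> two_sided_ideal S \<Longrightarrow> - a \<in> two_sided_ideal S"
  using two_sided_ideal.mult_left[of a S "-1"] by simp

lemma ideal_diff:
  "a \<in> two_sided_ideal S \<Longrightarrow> b \<in> two_sided_ideal S \<Longrightarrow> a - b \<in> two_sided_ideal S"
  using two_sided_ideal.add[OF _ ideal_uminus, of a S b] by simp

lemma equivp_uea_cong: "equivp (uea_cong sc br)"
proof (rule equivpI)
  show "reflp (uea_cong sc br)"
    by (simp add: reflp_def uea_cong_def two_sided_ideal.zero)
  show "symp (uea_cong sc br)"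
  proof (rule sympI)
    fix p q assume "uea_cong sc br p q"
    then show "uea_cong sc br q p"
      unfolding uea_cong_def using ideal_uminus[of "p - q"] by simp
  qed
  show "transp (uea_cong sc br)"
  proof (rule transpI)
    fix p q r assume "uea_cong sc br p q" "uea_cong sc br q r"
    then show "uea_cong sc br p r"
      unfolding uea_cong_def using two_sided_ideal.add[of "p - q" _ "q - r"] by simp
  qed
qed

lemma uea_cong_add:
  "uea_cong s b p p' \<Longrightarrow> uea_cong s b q q' \<Longrightarrow> uea_cong s b (p + q) (p' + q')"
  unfolding uea_cong_def add_diff_add by (rule two_sided_ideal.add)

lemma uea_cong_uminus: "uea_cong s b p p' \<Longrightarrow> uea_cong s b (- p) (- p')"
  unfolding uea_cong_def using ideal_uminus[of "p - p'"] by simp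

lemma uea_cong_mult:
  assumes "uea_cong s b p p'" "uea_cong s b q q'"
  shows "uea_cong s b (p * q) (p' * q')"
proof -
  have "p * q - p' * q' = (p - p') * q + p' * (q - q')"
    by (simp add: algebra_simps)
  with assms show ?thesis
    unfolding uea_cong_def
    by (simp add: two_sided_ideal.add two_sided_ideal.mult_left two_sided_ideal.mult_right)
qed

text \<open>The extension of a map on the generators to the free algebra.\<close>

definition free_ext ::
  "('f::field \<Rightarrow> 'a::ring_1 \<Rightarrow> 'a) \<Rightarrow> ('v \<Rightarrow> 'a) \<Rightarrow> ('v, 'f) free_algebra \<Rightarrow> 'a"
  where "free_ext sA f p =
     (\<Sum>w\<in>Poly_Mapping.keys p. sA (Poly_Mapping.lookup p w) (prod_list (map f (letters w))))"

lemma free_algebra_expand: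
  "p = (\<Sum>w\<in>Poly_Mapping.keys p. Poly_Mapping.single w (Poly_Mapping.lookup p w))"
    for p :: "'k \<Rightarrow>\<^sub>0 'f::field"
proof (rule poly_mapping_eqI)
  fix k
  have "Poly_Mapping.lookup (\<Sum>w\<in>Poly_Mapping.keys p.
          Poly_Mapping.single w (Poly_Mapping.lookup p w)) k =
        (\<Sum>w\<in>Poly_Mapping.keys p. if w = k then Poly_Mapping.lookup p w else 0)"
    by (simp add: lookup_sum lookup_single when_def)
  also have "\<dots> = Poly_Mapping.lookup p k"
    by (simp add: in_keys_iff)
  finally show "Poly_Mapping.lookup p k = Poly_Mapping.lookup (\<Sum>w\<in>Poly_Mapping.keys p.
          Poly_Mapping.single w (Poly_Mapping.lookup p w)) k" by simp
qed

context assoc_algebra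
begin

lemma free_ext_superset:
  assumes "finite K" "Poly_Mapping.keys p \<subseteq> K"
  shows "free_ext scale f p =
    (\<Sum>w\<in>K. scale (Poly_Mapping.lookup p w) (prod_list (map f (letters w))))"
  unfolding free_ext_def using assms
  by (intro sum.mono_neutral_left) (auto simp: in_keys_iff)

lemma free_ext_add: "free_ext scale f (p + q) = free_ext scale f p + free_ext scale f q"
proof -
  let ?K = "Poly_Mapping.keys p \<union> Poly_Mapping.keys q"
  have "Poly_Mapping.keys (p + q) \<subseteq> ?K" by (rule keys_add)
  then show ?thesis
    by (simp add: free_ext_superset[of ?K] lookup_add scale_left_distrib sum.distrib)
qed

lemma free_ext_zero: "free_ext scale f 0 = 0"
  by (simp add: free_ext_def)

lemma free_ext_sum: "free_ext scale f (sum g A) = (\<Sum>i\<in>A. free_ext scale f (g i))"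
  by (induction A rule: infinite_finite_induct) (simp_all add: free_ext_zero free_ext_add)

lemma free_ext_single:
  "free_ext scale f (Poly_Mapping.single w c) = scale c (prod_list (map f (letters w)))"
  by (simp add: free_ext_superset[of "{w}"])

lemma free_ext_mult: "free_ext scale f (p * q) = free_ext scale f p * free_ext scale f q"
proof -
  let ?s = "\<lambda>p w. Poly_Mapping.single w (Poly_Mapping.lookup p w)"
  have 1: "p * q = (\<Sum>w\<in>Poly_Mapping.keys p. \<Sum>v\<in>Poly_Mapping.keys q. ?s p w * ?s q v)"
    by (subst (1) free_algebra_expand[of p], subst (1) free_algebra_expand[of q])
      (simp only: sum_product)
  show ?thesis
    unfolding 1 free_ext_sum mult_single free_ext_single
    by (simp add: free_ext_def sum_product plus_free_word_def scale_mult_left scale_mult_right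
        mult.commute)
qed

lemma free_ext_one: "free_ext scale f 1 = 1"
  using free_ext_single[of f 0 1] by simp

lemma free_ext_diff: "free_ext scale f (p - q) = free_ext scale f p - free_ext scale f q"
  using free_ext_add[of f "p - q" q] by simp

lemma free_ext_gen: "free_ext scale f (free_gen v) = f v"
  by (simp add: free_gen_def free_ext_single)

lemma free_ext_scale: "free_ext scale f (free_scale c p) = scale c (free_ext scale f p)"
  by (simp add: free_scale_def free_ext_mult free_ext_single zero_free_word_def scale_mult_left)

lemma free_ext_ideal:
  assumes add: "\<And>x y. f (x + y) = f x + f y"
    and sc: "\<And>c x. f (sc c x) = scale c (f x)"
    and br: "\<And>x y. f (br x y) = f x * f y - f y * f x"
    and p: "p \<in> two_sided_ideal (uea_relators sc br)"
  shows "free_ext scale f p = 0"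
  using p
proof (induction rule: two_sided_ideal.induct)
  case (gen a)
  then show ?case
    by (auto simp: uea_relators_def free_ext_diff free_ext_gen free_ext_scale free_ext_mult
        add sc br)
qed (simp_all add: free_ext_zero free_ext_add free_ext_mult)

end


section \<open>The Lie algebra \<open>\<nn>\<^sub>5\<^sub>,\<^sub>4\<close>\<close>

text \<open>The basis element \<open>x\<^sub>i\<close> is the \<open>i\<close>-th unit vector (in the index type, \<open>5\<close> is \<open>0\<close>).\<close>

definition n54_x :: "5 \<Rightarrow> 'f::field ^ 5"
  where "n54_x i = axis i 1"

text \<open>
  The bilinear alternating extension of \<open>[x\<^sub>4, x\<^sub>3] = - x\<^sub>1\<close>,
  \<open>[x\<^sub>5, x\<^sub>2] = - x\<^sub>1\<close>, \<open>[x\<^sub>5, x\<^sub>4] = - x\<^sub>2\<close>.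
\<close>

definition n54_bracket :: "'f::field ^ 5 \<Rightarrow> 'f ^ 5 \<Rightarrow> 'f ^ 5"
  where "n54_bracket u v =
     (u $ 4 * v $ 3 - u $ 3 * v $ 4) *s (- n54_x 1) +
     (u $ 5 * v $ 2 - u $ 2 * v $ 5) *s (- n54_x 1) +
     (u $ 5 * v $ 4 - u $ 4 * v $ 5) *s (- n54_x 2)"

lemma exhaust_5: "i = 1 \<or> i = 2 \<or> i = 3 \<or> i = 4 \<or> i = 5" for i :: 5
proof (induct i)
  case (of_int z)
  then have "0 \<le> z" and "z < 5" by simp_all
  then have "z = 0 \<or> z = 1 \<or> z = 2 \<or> z = 3 \<or> z = 4" by arith
  then show ?case by auto
qed

lemma n54_x_basis:
  "vec.independent (range n54_x :: ('f::field ^ 5) set)"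
  "vec.span (range n54_x :: ('f::field ^ 5) set) = UNIV"
  "inj (n54_x :: 5 \<Rightarrow> 'f::field ^ 5)"
proof -
  have *: "range n54_x = (cart_basis :: ('f ^ 5) set)"
    by (auto simp: n54_x_def cart_basis_def)
  show "vec.independent (range n54_x :: ('f ^ 5) set)"
    using independent_cart_basis by (simp only: *)
  show "vec.span (range n54_x :: ('f ^ 5) set) = UNIV"
    using span_cart_basis by (simp only: *)
  show "inj (n54_x :: 5 \<Rightarrow> 'f ^ 5)"
    by (rule injI) (simp add: n54_x_def axis_eq_axis)
qed

lemma n54_x_nth: "n54_x i $ j = (if i = j then 1 else 0)"
  by (auto simp: n54_x_def axis_def)

lemma n54_bracket_nth:
  "n54_bracket u v $ 1 = u $ 3 * v $ 4 - u $ 4 * v $ 3 + u $ 2 * v $ 5 - u $ 5 * v $ 2"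
  "n54_bracket u v $ 2 = u $ 4 * v $ 5 - u $ 5 * v $ 4"
  "n54_bracket u v $ 3 = 0"  "n54_bracket u v $ 4 = 0"  "n54_bracket u v $ 5 = 0"
  by (simp_all add: n54_bracket_def n54_x_nth)

lemma vec5_eqI:
  fixes u v :: "'f ^ 5"
  assumes "u $ 1 = v $ 1" "u $ 2 = v $ 2" "u $ 3 = v $ 3" "u $ 4 = v $ 4" "u $ 5 = v $ 5"
  shows "u = v"
proof -
  have "u $ i = v $ i" for i
    using exhaust_5[of i] assms by (elim disjE) (simp_all only:)
  then show ?thesis
    by (simp add: vec_eq_iff)
qed

lemma lie_algebra_n54: "lie_algebra (*s) (n54_bracket :: 'f::field ^ 5 \<Rightarrow> _)"
proof unfold_locales
  fix x y z :: "'f ^ 5" and c :: 'f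
  note [simp del] = One_nat_def
  show "n54_bracket (x + y) z = n54_bracket x z + n54_bracket y z"
    by (rule vec5_eqI) (simp_all only: n54_bracket_nth vector_add_component, simp_all add: algebra_simps)
  show "n54_bracket x (y + z) = n54_bracket x y + n54_bracket x z"
    by (rule vec5_eqI) (simp_all only: n54_bracket_nth vector_add_component, simp_all add: algebra_simps)
  show "n54_bracket (c *s x) y = c *s n54_bracket x y"
    by (rule vec5_eqI) (simp_all only: n54_bracket_nth vector_smult_component, simp_all add: algebra_simps)
  show "n54_bracket x (c *s y) = c *s n54_bracket x y"
    by (rule vec5_eqI) (simp_all only: n54_bracket_nth vector_smult_component, simp_all add: algebra_simps)
  show "n54_bracket x x = 0"
    by (rule vec5_eqI) (simp_all only: n54_bracket_nth zero_index, simp_all add: algebra_simps)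
  show "n54_bracket x (n54_bracket y z) + n54_bracket y (n54_bracket z x)
      + n54_bracket z (n54_bracket x y) = 0"
    by (rule vec5_eqI) (simp_all only: n54_bracket_nth vector_add_component zero_index, simp_all add: algebra_simps)
qed

lemma n54_bracket_basis:
  "n54_bracket (n54_x i) (n54_x j :: 'f::field ^ 5) =
     (if i = 4 \<and> j = 3 then - n54_x 1
      else if i = 3 \<and> j = 4 then n54_x 1
      else if i = 5 \<and> j = 2 then - n54_x 1
      else if i = 2 \<and> j = 5 then n54_x 1
      else if i = 5 \<and> j = 4 then - n54_x 2
      else if i = 4 \<and> j = 5 then n54_x 2
      else 0)"
proof -
  have ne: "(1::5) \<noteq> 2" "(1::5) \<noteq> 3" "(1::5) \<noteq> 4" "(1::5) \<noteq> 5" "(2::5) \<noteq> 3" "(2::5) \<noteq> 4"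
    "(2::5) \<noteq> 5" "(3::5) \<noteq> 4" "(3::5) \<noteq> 5" "(4::5) \<noteq> 5"
    by simp_all
  note ne' = ne ne[symmetric]
  have A: "n54_bracket (n54_x i) (n54_x j :: 'f ^ 5) =
     ((if i = 4 \<and> j = 3 then 1 else 0) - (if i = 3 \<and> j = 4 then 1 else 0)) *s (- n54_x 1) +
     ((if i = 5 \<and> j = 2 then 1 else 0) - (if i = 2 \<and> j = 5 then 1 else 0)) *s (- n54_x 1) +
     ((if i = 5 \<and> j = 4 then 1 else 0) - (if i = 4 \<and> j = 5 then 1 else 0)) *s (- n54_x 2)"
    by (simp add: n54_bracket_def n54_x_nth)
  show ?thesis
    using exhaust_5[of i] exhaust_5[of j] unfolding A
    by (elim disjE) (simp_all only: ne' if_True if_False simp_thms, simp_all)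
qed


section \<open>The universal enveloping algebra of \<open>\<nn>\<^sub>5\<^sub>,\<^sub>4\<close>\<close>

quotient_type (overloaded) 'f n54_uea =
  "('f::field ^ 5, 'f) free_algebra" / "uea_cong (*s) n54_bracket"
  by (rule equivp_uea_cong)

instantiation n54_uea :: (field) ring_1
begin

lift_definition zero_n54_uea :: "'a n54_uea" is 0 .
lift_definition one_n54_uea :: "'a n54_uea" is 1 .
lift_definition plus_n54_uea :: "'a n54_uea \<Rightarrow> 'a n54_uea \<Rightarrow> 'a n54_uea" is "(+)"
  by (rule uea_cong_add)
lift_definition uminus_n54_uea :: "'a n54_uea \<Rightarrow> 'a n54_uea" is uminus
  by (rule uea_cong_uminus)
lift_definition minus_n54_uea :: "'a n54_uea \<Rightarrow> 'a n54_uea \<Rightarrow> 'a n54_uea" is "(-)"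
  using uea_cong_add[OF _ uea_cong_uminus] by fastforce
lift_definition times_n54_uea :: "'a n54_uea \<Rightarrow> 'a n54_uea \<Rightarrow> 'a n54_uea" is "(*)"
  by (rule uea_cong_mult)

instance
proof
  fix a b c :: "'a n54_uea"
  have refl: "uea_cong (*s) n54_bracket p p" for p :: "('a ^ 5, 'a) free_algebra"
    by (rule equivp_reflp[OF equivp_uea_cong])
  show "a * b * c = a * (b * c)" "1 * a = a" "a * 1 = a" "a + b + c = a + (b + c)"
    "a + b = b + a" "0 + a = a" "- a + a = 0" "a - b = a + - b"
    "(a + b) * c = a * c + b * c" "a * (b + c) = a * b + a * c"
    by (transfer, simp add: algebra_simps refl)+
  interpret assoc_algebra "(*) :: 'a \<Rightarrow> 'a \<Rightarrow> 'a"
    by unfold_locales (simp_all add: algebra_simps)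
  have "(0 :: ('a ^ 5, 'a) free_algebra) - 1 \<notin> two_sided_ideal (uea_relators (*s) n54_bracket)"
  proof
    assume "(0 :: ('a ^ 5, 'a) free_algebra) - 1 \<in> two_sided_ideal (uea_relators (*s) n54_bracket)"
    then have "free_ext (*) (\<lambda>_. 0) ((0 :: ('a ^ 5, 'a) free_algebra) - 1) = (0 :: 'a)"
      by (intro free_ext_ideal) simp_all
    then show False
      unfolding free_ext_diff free_ext_zero free_ext_one by simp
  qed
  then show "(0 :: 'a n54_uea) \<noteq> 1"
    by transfer (simp add: uea_cong_def)
qed

end

lift_definition n54_scale :: "'f::field \<Rightarrow> 'f n54_uea \<Rightarrow> 'f n54_uea" is free_scale
  unfolding free_scale_def
  by (intro uea_cong_mult equivp_reflp[OF equivp_uea_cong])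

lift_definition n54_iota :: "'f::field ^ 5 \<Rightarrow> 'f n54_uea" is free_gen .

text \<open>
  The pair \<open>(n54_uea, n54_iota)\<close> has the universal property of the universal enveloping algebra.
\<close>

lemma assoc_algebra_n54: "assoc_algebra (n54_scale :: 'f::field \<Rightarrow> _)"
proof
  fix a b :: 'f and x y :: "'f n54_uea"
  have refl: "uea_cong (*s) n54_bracket p p" for p :: "('f ^ 5, 'f) free_algebra"
    by (rule equivp_reflp[OF equivp_uea_cong])
  have comm: "q * Poly_Mapping.single 0 c = Poly_Mapping.single 0 c * q"
    for c and q :: "('f ^ 5, 'f) free_algebra"
    by (subst (1 2) free_algebra_expand[of q])
      (simp add: sum_distrib_left sum_distrib_right mult_single mult.commute)
  show "n54_scale a (x + y) = n54_scale a x + n54_scale a y"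
    by transfer (simp add: free_scale_def algebra_simps refl)
  show "n54_scale (a + b) x = n54_scale a x + n54_scale b x"
    by transfer (simp add: free_scale_def algebra_simps single_add refl)
  show "n54_scale a (n54_scale b x) = n54_scale (a * b) x"
    by transfer (simp add: free_scale_def mult.assoc[symmetric] mult_single refl)
  show "n54_scale 1 x = x"
    by transfer (simp add: free_scale_def refl)
  show "n54_scale a x * y = n54_scale a (x * y)"
    by transfer (simp add: free_scale_def mult.assoc refl)
  show "x * n54_scale a y = n54_scale a (x * y)"
  proof transfer
    fix a and x y :: "('f ^ 5, 'f) free_algebra"
    have "x * free_scale a y = free_scale a (x * y)"
      unfolding free_scale_def by (metis comm mult.assoc)
    then show "uea_cong (*s) n54_bracket (x * free_scale a y) (free_scale a (x * y))"
      by (simp add: refl)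
  qed
qed

lemma relator_cong:
  "p - q \<in> uea_relators sc br \<Longrightarrow> uea_cong sc br p q"
  by (simp add: uea_cong_def two_sided_ideal.gen)

lemma linear_n54_iota: "Vector_Spaces.linear (*s) n54_scale (n54_iota :: 'f::field ^ 5 \<Rightarrow> _)"
proof -
  interpret assoc_algebra "n54_scale :: 'f \<Rightarrow> _"
    by (rule assoc_algebra_n54)
  show ?thesis
  proof
    fix x y :: "'f ^ 5" and c :: 'f
    show "n54_iota (x + y) = n54_iota x + n54_iota y"
      by transfer (rule relator_cong, auto simp: uea_relators_def diff_diff_eq)
    show "n54_iota (c *s x) = n54_scale c (n54_iota x)"
      by transfer (rule relator_cong, auto simp: uea_relators_def)
  qed
qed

lemma n54_iota_bracket:
  "n54_iota (n54_bracket x y) = n54_iota x * n54_iota y - n54_iota y * n54_iota x"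
  by transfer (rule relator_cong, auto simp: uea_relators_def)

theorem n54_uea_universal:
  fixes sA :: "'f::field \<Rightarrow> 'a::ring_1 \<Rightarrow> 'a" and f :: "'f ^ 5 \<Rightarrow> 'a"
  assumes A: "assoc_algebra sA"
    and lin: "Vector_Spaces.linear (*s) sA f"
    and br: "\<And>x y. f (n54_bracket x y) = f x * f y - f y * f x"
  shows "\<exists>!h. algebra_hom n54_scale sA h \<and> (\<forall>x. h (n54_iota x) = f x)"
proof -
  interpret A: assoc_algebra sA by (rule A)
  interpret U: assoc_algebra "n54_scale :: 'f \<Rightarrow> _" by (rule assoc_algebra_n54)
  interpret f: Vector_Spaces.linear "(*s)" sA f by (rule lin)
  have wd: "free_ext sA f p = free_ext sA f q" if "uea_cong (*s) n54_bracket p q" for p q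
    using A.free_ext_ideal[OF f.add f.scale br] that[unfolded uea_cong_def]
    by (metis A.free_ext_diff eq_iff_diff_eq_0)
  define h where "h u = free_ext sA f (rep_n54_uea u)" for u
  have h_abs: "h (abs_n54_uea p) = free_ext sA f p" for p
    unfolding h_def
    by (rule wd) (simp add: n54_uea.abs_eq_iff[symmetric] Quotient3_abs_rep[OF Quotient3_n54_uea])
  have abs_surj: "\<exists>p. u = abs_n54_uea p" for u :: "'f n54_uea"
    by (rule exI[of _ "rep_n54_uea u"]) (simp add: Quotient3_abs_rep[OF Quotient3_n54_uea])
  have hom: "algebra_hom n54_scale sA h"
    unfolding algebra_hom_def
  proof (intro conjI allI)
    show "Vector_Spaces.linear n54_scale sA h"
    proof
      fix u v :: "'f n54_uea" and c :: 'f
      obtain p q where "u = abs_n54_uea p" "v = abs_n54_uea q"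
        using abs_surj by blast
      then show "h (u + v) = h u + h v" "h (n54_scale c u) = sA c (h u)"
        by (simp_all add: plus_n54_uea.abs_eq n54_scale.abs_eq h_abs A.free_ext_add
            A.free_ext_scale)
    qed
    show "h 1 = 1"
      by (simp add: one_n54_uea_def h_abs A.free_ext_one)
    fix u v :: "'f n54_uea"
    obtain p q where "u = abs_n54_uea p" "v = abs_n54_uea q"
      using abs_surj by blast
    then show "h (u * v) = h u * h v"
      by (simp add: times_n54_uea.abs_eq h_abs A.free_ext_mult)
  qed
  have iota: "h (n54_iota x) = f x" for x
    by (simp add: n54_iota.abs_eq h_abs A.free_ext_gen)
  have unique: "h' = h" if h': "algebra_hom n54_scale sA h'" "\<forall>x. h' (n54_iota x) = f x" for h'
  proof
    fix u :: "'f n54_uea"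
    interpret h': Vector_Spaces.linear n54_scale sA h'
      using h'(1) by (simp add: algebra_hom_def)
    have h'_one: "h' 1 = 1" and h'_mult: "h' (u * v) = h' u * h' v" for u v
      using h'(1) by (simp_all add: algebra_hom_def)
    have word: "h' (abs_n54_uea (Poly_Mapping.single (Free_Word ws) 1)) = prod_list (map f ws)"
      for ws
    proof (induction ws)
      case Nil
      have "Poly_Mapping.single (Free_Word []) 1 = (1 :: ('f ^ 5, 'f) free_algebra)"
        by (simp add: zero_free_word_def[symmetric])
      then show ?case
        using h'_one by (simp add: one_n54_uea_def)
    next
      case (Cons x ws)
      have "Poly_Mapping.single (Free_Word (x # ws)) 1 =
            free_gen x * (Poly_Mapping.single (Free_Word ws) 1 :: ('f ^ 5, 'f) free_algebra)"
        by (simp add: free_gen_def mult_single plus_free_word_def)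
      then have "abs_n54_uea (Poly_Mapping.single (Free_Word (x # ws)) 1) =
            n54_iota x * abs_n54_uea (Poly_Mapping.single (Free_Word ws) 1)"
        by (simp add: n54_iota.abs_eq times_n54_uea.abs_eq)
      then show ?case
        using Cons h'(2) by (simp add: h'_mult)
    qed
    have single: "h' (abs_n54_uea (Poly_Mapping.single w c)) = free_ext sA f (Poly_Mapping.single w c)"
      for w c
    proof -
      have "Poly_Mapping.single w c = free_scale c (Poly_Mapping.single w 1)"
        by (simp add: free_scale_def mult_single)
      then have "abs_n54_uea (Poly_Mapping.single w c) =
          n54_scale c (abs_n54_uea (Poly_Mapping.single w 1))"
        by (simp add: n54_scale.abs_eq)
      then show ?thesis
        using word[of "letters w"] by (simp add: h'.scale A.free_ext_single)
    qed
    have sum: "h' (abs_n54_uea (sum g W)) = (\<Sum>w\<in>W. h' (abs_n54_uea (g w)))"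
      for g :: "('f ^ 5) free_word \<Rightarrow> ('f ^ 5, 'f) free_algebra" and W
      by (induction W rule: infinite_finite_induct)
        (simp_all add: zero_n54_uea_def[symmetric] h'.zero plus_n54_uea.abs_eq[symmetric] h'.add)
    obtain p where u: "u = abs_n54_uea p"
      using abs_surj by blast
    have "h' u = free_ext sA f p"
      unfolding u
      by (subst (1 2) free_algebra_expand[of p]) (simp only: sum single A.free_ext_sum)
    then show "h' u = h u"
      by (simp add: u h_abs)
  qed
  show ?thesis
    using hom iota unique by blast
qed

end

theory Submission
  imports Defs "HOL-Library.Function_Algebras"
begin

text \<open>
  Sorting the product into the order \<open>x\<^sub>1, \<dots>, x\<^sub>5\<close> requires exactly three exchanges, since
  \<open>x\<^sub>1\<close> is central and all other pairs commute: \<open>x\<^sub>5\<^sup>n\<close> past \<open>x\<^sub>2\<^sup>q\<close>, then the remaining power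
  of \<open>x\<^sub>5\<close> past \<open>x\<^sub>4\<^sup>s\<close>, and \<open>x\<^sub>4\<^sup>m\<close> past \<open>x\<^sub>3\<^sup>r\<close>. They produce the sums over \<open>\<alpha>\<close>, over
  \<open>(\<beta>\<^sub>1, \<beta>\<^sub>2)\<close> and over \<open>\<gamma>\<close>, respectively.

  All three are instances of one identity, \<open>power_mult_power_expand\<close>. Let \<open>b a = a b + c\<close> and
  \<open>b c = c b + 2 h\<close>, where \<open>a\<close>, \<open>c\<close>, \<open>h\<close> commute with each other and \<open>h\<close> commutes with \<open>b\<close>.
  Then the commutator with \<open>b\<close> sends \<open>a\<close> to \<open>c\<close>, \<open>c\<close> to \<open>2 h\<close> and \<open>h\<close> to \<open>0\<close>, so the Leibniz rule gives
    \<open>b\<^sup>N a = a b\<^sup>N + N c b\<^sup>N\<^sup>-\<^sup>1 + N (N - 1) h b\<^sup>N\<^sup>-\<^sup>2\<close>.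
  Regard \<open>b\<^sup>N a\<^sup>s\<close> as a function of \<open>N\<close>. Right multiplication by \<open>a\<close> acts on it as the sum of three
  operators of the form
    \<open>F \<mapsto> (N \<mapsto> N (N - 1) \<dots> (N - i + 1) z F(N - i))\<close>
  with \<open>(i, z)\<close> equal to \<open>(0, a)\<close>, \<open>(1, c)\<close> and \<open>(2, h)\<close>. Falling factorials compose, so these
  operators multiply by adding the \<open>i\<close> and multiplying the \<open>z\<close> (\<open>falling_shift_compose\<close>); in
  particular the three commute. Hence \<open>b\<^sup>N a\<^sup>s\<close> is the \<open>s\<close>-th power of their sum applied to
  \<open>N \<mapsto> b\<^sup>N\<close>, and the binomial theorem, used twice, yields the multinomial coefficients.

  For \<open>x\<^sub>5\<close> and \<open>x\<^sub>4\<close> one has \<open>c = - x\<^sub>2\<close> and \<open>h = x\<^sub>1 / 2\<close>, which explains the factor \<open>2\<close> to the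
  power \<open>\<beta>\<^sub>2\<close> in the denominator. The other two exchanges are of Heisenberg type: \<open>c = - x\<^sub>1\<close>
  and \<open>h = 0\<close>.
\<close>

section \<open>The binomial theorem for commuting additive operators\<close>

lemma additive_of_nat_mult:
  fixes P :: "'v::ring_1 \<Rightarrow> 'v"
  assumes "\<And>x y. P (x + y) = P x + P y"
  shows "P (of_nat n * x) = of_nat n * P x"
proof -
  have "P 0 = 0" using assms[of 0 0] by simp
  then show ?thesis by (induction n) (simp_all add: distrib_right assms)
qed

lemma additive_sum:
  fixes P :: "'v::ring_1 \<Rightarrow> 'v"
  assumes "\<And>x y. P (x + y) = P x + P y"
  shows "P (sum g A) = (\<Sum>i\<in>A. P (g i))"
proof -
  have "P 0 = 0" using assms[of 0 0] by simp
  then show ?thesis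
    by (induction A rule: infinite_finite_induct) (simp_all add: assms)
qed

text \<open>
  The operators act on a ring only so that binomial coefficients can be written as
  \<^term>\<open>of_nat\<close>. In the application it is a ring of functions with pointwise operations.
\<close>

lemma binomial_additive_operators:
  fixes P Q :: "'v::ring_1 \<Rightarrow> 'v"
  assumes P: "\<And>x y. P (x + y) = P x + P y"
    and Q: "\<And>x y. Q (x + y) = Q x + Q y"
    and PQ: "\<And>x. P (Q x) = Q (P x)"
  shows "((\<lambda>x. P x + Q x) ^^ s) x =
    (\<Sum>u\<le>s. of_nat (s choose u) * (P ^^ (s - u)) ((Q ^^ u) x))"
proof (induction s)
  case 0
  show ?case by simp
next
  case (Suc s)
  \<comment> \<open>The new factor \<open>Q\<close> has to pass the powers of \<open>P\<close>; then Pascal's rule combines the two sums.\<close>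
  have QP: "Q ((P ^^ i) y) = (P ^^ i) (Q y)" for i y
    by (induction i) (simp_all add: PQ[symmetric])
  define T where "T u = (P ^^ (Suc s - u)) ((Q ^^ u) x)" for u
  have "((\<lambda>x. P x + Q x) ^^ Suc s) x =
      (\<Sum>u\<le>s. of_nat (s choose u) * P ((P ^^ (s - u)) ((Q ^^ u) x))) +
      (\<Sum>u\<le>s. of_nat (s choose u) * Q ((P ^^ (s - u)) ((Q ^^ u) x)))"
    by (simp add: Suc additive_sum[of P, OF P] additive_sum[of Q, OF Q]
        additive_of_nat_mult[of P, OF P] additive_of_nat_mult[of Q, OF Q])
  also have "\<dots> = (\<Sum>u\<le>s. of_nat (s choose u) * T u) + (\<Sum>u\<le>s. of_nat (s choose u) * T (Suc u))"
    by (intro arg_cong2[of _ _ _ _ "(+)"] sum.cong) (simp_all add: T_def QP Suc_diff_le)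
  also have "(\<Sum>u\<le>s. of_nat (s choose u) * T u) = (\<Sum>u\<le>Suc s. of_nat (s choose u) * T u)"
    by (simp add: binomial_eq_0)
  also have "\<dots> = T 0 + (\<Sum>u\<le>s. of_nat (s choose Suc u) * T (Suc u))"
    by (simp add: sum.atMost_Suc_shift del: sum.atMost_Suc)
  also have "\<dots> + (\<Sum>u\<le>s. of_nat (s choose u) * T (Suc u)) =
      T 0 + (\<Sum>u\<le>s. of_nat (Suc s choose Suc u) * T (Suc u))"
    by (simp add: sum.distrib distrib_right add_ac)
  also have "\<dots> = (\<Sum>u\<le>Suc s. of_nat (Suc s choose u) * T u)"
    by (simp add: sum.atMost_Suc_shift del: sum.atMost_Suc binomial_Suc_Suc)
  finally show ?case by (simp only: T_def)
qed

section \<open>Shift operators weighted by falling factorials\<close>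

text \<open>
  Both sides count the injective words of length \<open>i + j\<close> over \<open>n\<close> letters: the falling
  factorial of length \<open>i + j\<close> starting at \<open>n\<close> splits after its first \<open>i\<close> factors.
\<close>

lemma choose_fact_mult:
  "(n choose i) * fact i * (((n - i) choose j) * fact j) = (n choose (i + j)) * (fact (i + j) :: nat)"
proof (cases "i + j \<le> n")
  case True
  have "(n choose i) * ((n - i) choose j) = (n choose (i + j)) * ((i + j) choose i)"
    using choose_mult[of i "i + j" n] True by simp
  moreover have "fact (i + j) = fact i * fact j * ((i + j) choose i)"
    using binomial_fact_lemma[of i "i + j"] by simp
  ultimately show ?thesis
    by (metis (no_types, lifting) mult.assoc mult.commute)
next
  case False
  then show ?thesis by (cases "i \<le> n") (auto simp: binomial_eq_0)
qed

text \<open>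
  The falling factorial is written as \<open>(N choose i) * fact i\<close>, which vanishes for \<open>i > N\<close>. Hence the
  value of \<open>F\<close> at the truncated difference \<open>N - i\<close> never matters in that case.
\<close>

definition falling_shift :: "nat \<Rightarrow> 'a \<Rightarrow> (nat \<Rightarrow> 'a) \<Rightarrow> nat \<Rightarrow> 'a::ring_1"
  where "falling_shift i z F = (\<lambda>N. of_nat ((N choose i) * fact i) * (z * F (N - i)))"

lemma falling_shift_add:
  "falling_shift i z (F + G) = falling_shift i z F + falling_shift i z G"
  by (simp add: falling_shift_def fun_eq_iff distrib_left)

lemma falling_shift_compose:
  "falling_shift i z (falling_shift j y F) = falling_shift (i + j) (z * y) F"
proof
  fix N
  let ?k = "(N choose i) * fact i" and ?l = "((N - i) choose j) * fact j"
  have "falling_shift i z (falling_shift j y F) N = of_nat ?k * (z * (of_nat ?l * (y * F (N - i - j))))"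
    by (simp only: falling_shift_def)
  also have "\<dots> = of_nat ?k * (of_nat ?l * (z * (y * F (N - i - j))))"
    by (metis mult.assoc mult_of_nat_commute)
  also have "\<dots> = of_nat (?k * ?l) * (z * (y * F (N - i - j)))"
    by (simp only: of_nat_mult mult.assoc)
  also have "?k * ?l = (N choose (i + j)) * fact (i + j)"
    by (rule choose_fact_mult)
  finally show "falling_shift i z (falling_shift j y F) N = falling_shift (i + j) (z * y) F N"
    by (simp only: falling_shift_def mult.assoc diff_diff_left)
qed

lemma falling_shift_funpow: "(falling_shift i z ^^ w) F = falling_shift (w * i) (z ^ w) F"
proof (induction w)
  case 0
  show ?case by (simp add: falling_shift_def)
next
  case (Suc w)
  then show ?case by (simp add: falling_shift_compose)
qed

lemma falling_shift_commute:
  assumes "z * y = y * z"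
  shows "falling_shift i z (falling_shift j y F) = falling_shift j y (falling_shift i z F)"
  by (simp add: falling_shift_compose assms add.commute)

section \<open>Moving a power past a power\<close>

text \<open>
  The recursion step for the exponent of \<open>a\<close>. Parametrizing the second commutator as \<open>2 * h\<close> turns
  the coefficient \<open>N choose 2\<close> of \<open>2 * h\<close> into the falling factorial \<open>N (N - 1)\<close> of \<open>h\<close>, so that
  no division occurs and the three summands have the common shape of \<^const>\<open>falling_shift\<close>.
\<close>

lemma power_mult_expand:
  fixes a b c h :: "'a::ring_1"
  assumes ba: "b * a = a * b + c" and bc: "b * c = c * b + 2 * h" and bh: "b * h = h * b"
  shows "b ^ N * a = a * b ^ N + of_nat N * (c * b ^ (N - 1)) + of_nat ((N choose 2) * 2) * (h * b ^ (N - 2))"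
proof (induction N)
  case 0
  show ?case by (simp add: binomial_eq_0)
next
  case (Suc N)
  let ?t = "of_nat ((N choose 2) * 2) :: 'a"
  have comm: "b * (of_nat i * z) = of_nat i * (b * z)" for i z
    by (metis mult.assoc mult_of_nat_commute)
  have 1: "b * (a * z) = a * (b * z) + c * z" "b * (c * z) = c * (b * z) + 2 * (h * z)"
    "b * (h * z) = h * (b * z)" for z
    by (simp_all add: mult.assoc[symmetric] ba bc bh distrib_right)
  have 2: "of_nat N * (c * (b * b ^ (N - 1))) = of_nat N * (c * b ^ N)"
    by (cases N) simp_all
  have 3: "?t * (h * (b * b ^ (N - 2))) = ?t * (h * b ^ (N - 1))"
  proof (cases "N \<ge> 2")
    case True
    then have "N - 1 = Suc (N - 2)" by simp
    then show ?thesis by simp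
  qed (simp add: binomial_eq_0)
  have 4: "(Suc N choose 2) * 2 = N * 2 + (N choose 2) * 2"
    by (simp add: numeral_2_eq_2)
  have "b ^ Suc N * a = b * (b ^ N * a)" by (simp add: mult.assoc)
  also have "\<dots> = a * (b * b ^ N) + c * b ^ N +
      (of_nat N * (c * (b * b ^ (N - 1))) + of_nat N * (2 * (h * b ^ (N - 1)))) +
      ?t * (h * (b * b ^ (N - 2)))"
    by (simp only: Suc distrib_left comm 1)
  also have "\<dots> = a * b ^ Suc N + of_nat (Suc N) * (c * b ^ (Suc N - 1)) +
     of_nat ((Suc N choose 2) * 2) * (h * b ^ (Suc N - 2))"
    unfolding 2 3 4 by (simp add: distrib_right mult.assoc add_ac)
  finally show ?case .
qed

lemma sum_fun_apply: "sum F I x = (\<Sum>i\<in>I. F i x)"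
  for F :: "'i \<Rightarrow> 'x \<Rightarrow> 'a::comm_monoid_add"
  by (induction I rule: infinite_finite_induct) simp_all

text \<open>
  The trinomial expansion of the \<open>s\<close>-th power of a sum of three commuting shift operators. The index
  \<open>\<beta>1\<close> counts the factors that contribute \<open>c\<close>, and \<open>\<beta>2\<close> those that contribute \<open>h\<close>; they lower the
  exponent of \<open>b\<close> by one and by two.
\<close>

lemma power_mult_power_expand:
  fixes a b c h :: "'a::ring_1"
  assumes ba: "b * a = a * b + c" and bc: "b * c = c * b + 2 * h" and bh: "b * h = h * b"
    and ac: "a * c = c * a" and ah: "a * h = h * a" and ch: "c * h = h * c"
  shows "b ^ N * a ^ s =
    (\<Sum>(\<beta>1, \<beta>2) \<in> {(\<beta>1, \<beta>2). \<beta>1 + \<beta>2 \<le> s \<and> \<beta>1 + 2 * \<beta>2 \<le> N}.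
       of_nat ((s choose (\<beta>1 + \<beta>2)) * ((\<beta>1 + \<beta>2) choose \<beta>1) *
         (N choose (\<beta>1 + 2 * \<beta>2)) * fact (\<beta>1 + 2 * \<beta>2)) *
       (h ^ \<beta>2 * c ^ \<beta>1 * a ^ (s - \<beta>1 - \<beta>2) * b ^ (N - \<beta>1 - 2 * \<beta>2)))"
proof -
  define G where "G s = (\<lambda>N. b ^ N * a ^ s)" for s
  define A where "A = falling_shift 0 a"
  define C where "C = falling_shift 1 c"
  define H where "H = falling_shift 2 h"
  note defs = A_def C_def H_def
  define summand where "summand v w = of_nat ((s choose (v + w)) * ((v + w) choose v)) *
    falling_shift (v + 2 * w) (h ^ w * c ^ v * a ^ (s - (v + w))) (G 0) N" for v w
  have swap: "a ^ i * (h ^ w * c ^ v) = h ^ w * c ^ v * a ^ i" for i v w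
  proof -
    have "h ^ w * c ^ v * a = a * (h ^ w * c ^ v)"
      by (metis ac ah mult.assoc power_commuting_commutes)
    then show ?thesis by (metis power_commuting_commutes)
  qed
  have vanish: "summand v w = 0" if "\<not> v + 2 * w \<le> N" for v w
    using that by (simp add: summand_def falling_shift_def binomial_eq_0)
  have step: "G (Suc s) = A (G s) + (H (G s) + C (G s))" for s
  proof
    fix N
    have "G (Suc s) N = (b ^ N * a) * a ^ s"
      by (simp add: G_def mult.assoc)
    also have "\<dots> = (A (G s) + (H (G s) + C (G s))) N"
      unfolding power_mult_expand[OF ba bc bh]
      by (simp add: defs G_def falling_shift_def distrib_right mult.assoc add_ac)
    finally show "G (Suc s) N = (A (G s) + (H (G s) + C (G s))) N" .
  qed
  have "G s = ((\<lambda>F. A F + (H F + C F)) ^^ s) (G 0)"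
    by (induction s) (simp_all add: step)
  also have "\<dots> = (\<Sum>u\<le>s. of_nat (s choose u) * (A ^^ (s - u)) (((\<lambda>F. H F + C F) ^^ u) (G 0)))"
    by (rule binomial_additive_operators)
      (simp_all add: defs falling_shift_add falling_shift_commute[OF ac] falling_shift_commute[OF ah] add_ac)
  also have "\<dots> = (\<Sum>u\<le>s. of_nat (s choose u) * (A ^^ (s - u)) (\<Sum>v\<le>u. of_nat (u choose v) * (H ^^ (u - v)) ((C ^^ v) (G 0))))"
    by (subst binomial_additive_operators)
      (simp_all add: defs falling_shift_add falling_shift_commute[OF ch])
  also have "\<dots> = (\<Sum>u\<le>s. \<Sum>v\<le>u. of_nat ((s choose u) * (u choose v)) *
      falling_shift (v + 2 * (u - v)) (h ^ (u - v) * c ^ v * a ^ (s - u)) (G 0))"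
    by (simp add: defs falling_shift_funpow falling_shift_add falling_shift_compose swap
      additive_sum[where P = "falling_shift _ _"] additive_of_nat_mult[where P = "falling_shift _ _"]
      sum_distrib_left mult.assoc mult.commute[of _ 2] add.commute)
  finally have "G s N = (\<Sum>u\<le>s. \<Sum>v\<le>u. summand v (u - v))"
    by (simp add: sum_fun_apply summand_def)
  \<comment> \<open>Here \<open>u\<close> counts the factors other than \<open>a\<close> and \<open>v\<close> those equal to \<open>c\<close>; pass to \<open>(v, u - v)\<close>.\<close>
  also have "\<dots> = (\<Sum>(u, v) \<in> Sigma {..s} (\<lambda>u. {..u}). summand v (u - v))"
    by (simp add: sum.Sigma)
  also have "\<dots> = (\<Sum>(v, w) \<in> {(v, w). v + w \<le> s}. summand v w)"
    by (rule sum.reindex_bij_witness[of _ "\<lambda>(v, w). (v + w, v)" "\<lambda>(u, v). (v, u - v)"]) auto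
  also have "\<dots> = (\<Sum>(v, w) \<in> {(v, w). v + w \<le> s \<and> v + 2 * w \<le> N}. summand v w)"
  proof (rule sum.mono_neutral_right)
    show "finite {(v, w). v + w \<le> s}"
      by (rule finite_subset[of _ "{..s} \<times> {..s}"]) auto
  qed (use vanish in auto)
  finally show ?thesis
    by (simp add: G_def summand_def falling_shift_def mult.assoc)
qed

text \<open>
  The case \<open>h = 0\<close>, where only the summands with second index \<open>0\<close> survive.
\<close>

lemma power_mult_power_heisenberg:
  fixes a b c :: "'a::ring_1"
  assumes ba: "b * a = a * b + c" and bc: "b * c = c * b" and ac: "a * c = c * a"
  shows "b ^ N * a ^ s = (\<Sum>u = 0..min N s.
     of_nat ((s choose u) * (N choose u) * fact u) * (c ^ u * a ^ (s - u) * b ^ (N - u)))"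
proof -
  let ?B = "{(v, w). v + w \<le> s \<and> v + 2 * w \<le> N}"
  have fin: "finite ?B"
    by (rule finite_subset[of _ "{..s} \<times> {..s}"]) auto
  have "b ^ N * a ^ s = (\<Sum>(v, w) \<in> ?B.
      of_nat ((s choose (v + w)) * ((v + w) choose v) * (N choose (v + 2 * w)) * fact (v + 2 * w)) *
      (0 ^ w * c ^ v * a ^ (s - v - w) * b ^ (N - v - 2 * w)))"
    by (rule power_mult_power_expand) (simp_all add: ba bc ac)
  also have "\<dots> = (\<Sum>(v, w) \<in> (\<lambda>u. (u, 0)) ` {0..min N s}.
      of_nat ((s choose (v + w)) * ((v + w) choose v) * (N choose (v + 2 * w)) * fact (v + 2 * w)) *
      (0 ^ w * c ^ v * a ^ (s - v - w) * b ^ (N - v - 2 * w)))"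
    by (rule sum.mono_neutral_right[OF fin]) (auto simp: power_0_left)
  also have "\<dots> = (\<Sum>u = 0..min N s.
     of_nat ((s choose u) * (N choose u) * fact u) * (c ^ u * a ^ (s - u) * b ^ (N - u)))"
    by (subst sum.reindex) (auto simp: inj_on_def)
  finally show ?thesis .
qed


section \<open>The product of two ordered monomials\<close>

text \<open>
  The formula uses only the commutation relations, so it holds for any five elements satisfying them
  in any associative algebra in characteristic zero.
\<close>

lemma n54_product_formula:
  fixes scale :: "'f::field_char_0 \<Rightarrow> 'a::ring_1 \<Rightarrow> 'a"
  assumes alg: "assoc_algebra scale"
    and c1: "x2 * x1 = x1 * x2" "x3 * x1 = x1 * x3" "x4 * x1 = x1 * x4" "x5 * x1 = x1 * x5"
    and c2: "x3 * x2 = x2 * x3" "x4 * x2 = x2 * x4" and c53: "x5 * x3 = x3 * x5"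
    and b43: "x4 * x3 = x3 * x4 - x1" and b52: "x5 * x2 = x2 * x5 - x1"
    and b54: "x5 * x4 = x4 * x5 - x2"
  shows "(x1 ^ j * x2 ^ k * x3 ^ l * x4 ^ m * x5 ^ n) *
         (x1 ^ p * x2 ^ q * x3 ^ r * x4 ^ s * x5 ^ t) =
    (\<Sum>\<alpha> = 0..min n q.
       \<Sum>(\<beta>1, \<beta>2) \<in> {(\<beta>1, \<beta>2). \<beta>1 + \<beta>2 \<le> s \<and> \<beta>1 + 2 * \<beta>2 \<le> n - \<alpha>}.
         \<Sum>\<gamma> = 0..min m r.
           scale
             (of_nat (n choose \<alpha>) * of_nat (q choose \<alpha>) * of_nat (s choose (\<beta>1 + \<beta>2)) *
              of_nat ((n - \<alpha>) choose (\<beta>1 + 2 * \<beta>2)) * of_nat ((\<beta>1 + \<beta>2) choose \<beta>1) *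
              of_nat (m choose \<gamma>) * of_nat (r choose \<gamma>) *
              fact \<alpha> * (fact (\<beta>1 + 2 * \<beta>2) / 2 ^ \<beta>2) * fact \<gamma> *
              (- 1) ^ (\<alpha> + \<beta>1 + \<gamma>))
             (x1 ^ (j + p + \<alpha> + \<beta>2 + \<gamma>) * x2 ^ (k + q - \<alpha> + \<beta>1) * x3 ^ (l + r - \<gamma>) *
              x4 ^ (m + s - \<gamma> - \<beta>1 - \<beta>2) * x5 ^ (n + t - \<alpha> - \<beta>1 - 2 * \<beta>2)))"
proof -
  interpret assoc_algebra scale by (rule alg)
  have of_nat_scale: "of_nat i * x = scale (of_nat i) x" for i x
    by (induction i) (simp_all add: scale_left_distrib distrib_right)
  have neg_power: "(- x) ^ i = scale ((- 1) ^ i) (x ^ i)" for x i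
    by (induction i) (simp_all add: scale_mult_left scale_mult_right)
  have scale_power: "scale d x ^ i = scale (d ^ i) (x ^ i)" for d x i
    by (induction i) (simp_all add: scale_mult_left scale_mult_right)
  note scalars = scale_mult_left scale_mult_right scale_scale
  have half: "scale (1 / 2) (2 * x) = x" for x
    using of_nat_scale[of 2 x] by simp
  \<comment> \<open>The scalars that the exchanges of \<open>x5\<close> with \<open>x2\<close>, \<open>x5\<close> with \<open>x4\<close>, and \<open>x4\<close> with \<open>x3\<close> contribute.\<close>
  define A where "A \<alpha> = ((- 1) ^ \<alpha> * of_nat ((q choose \<alpha>) * (n choose \<alpha>) * fact \<alpha>) :: 'f)" for \<alpha>
  define B where "B N \<beta>1 \<beta>2 = ((- 1) ^ \<beta>1 * ((1 / 2) ^ \<beta>2 *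
         of_nat ((s choose (\<beta>1 + \<beta>2)) * ((\<beta>1 + \<beta>2) choose \<beta>1) *
           (N choose (\<beta>1 + 2 * \<beta>2)) * fact (\<beta>1 + 2 * \<beta>2))) :: 'f)" for N \<beta>1 \<beta>2
  define C where "C \<gamma> = ((- 1) ^ \<gamma> * of_nat ((r choose \<gamma>) * (m choose \<gamma>) * fact \<gamma>) :: 'f)" for \<gamma>
  have e52: "x5 ^ n * x2 ^ q = (\<Sum>\<alpha> = 0..min n q. scale (A \<alpha>) (x1 ^ \<alpha> * x2 ^ (q - \<alpha>) * x5 ^ (n - \<alpha>)))"
    by (subst power_mult_power_heisenberg[where c = "- x1"])
      (simp_all add: b52 c1 A_def of_nat_scale neg_power scalars del: of_nat_mult)
  have e43: "x4 ^ m * x3 ^ r = (\<Sum>\<gamma> = 0..min m r. scale (C \<gamma>) (x1 ^ \<gamma> * x3 ^ (r - \<gamma>) * x4 ^ (m - \<gamma>)))"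
    by (subst power_mult_power_heisenberg[where c = "- x1"])
      (simp_all add: b43 c1 C_def of_nat_scale neg_power scalars del: of_nat_mult)
  have e54: "x5 ^ N * x4 ^ s = (\<Sum>(\<beta>1, \<beta>2) \<in> {(\<beta>1, \<beta>2). \<beta>1 + \<beta>2 \<le> s \<and> \<beta>1 + 2 * \<beta>2 \<le> N}.
      scale (B N \<beta>1 \<beta>2) (x1 ^ \<beta>2 * x2 ^ \<beta>1 * x4 ^ (s - \<beta>1 - \<beta>2) * x5 ^ (N - \<beta>1 - 2 * \<beta>2)))" for N
    by (subst power_mult_power_expand[where c = "- x2" and h = "scale (1 / 2) x1"])
      (simp_all add: b54 b52 c1 c2 half B_def of_nat_scale neg_power scale_power scalars mult.assoc del: of_nat_mult)
  have comm: "y ^ v * x ^ u = x ^ u * y ^ v" "y ^ v * (x ^ u * z) = x ^ u * (y ^ v * z)"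
    if "y * x = x * y" for x y z :: 'a and u v
  proof -
    show "y ^ v * x ^ u = x ^ u * y ^ v"
      using that by (metis power_commuting_commutes)
    then show "y ^ v * (x ^ u * z) = x ^ u * (y ^ v * z)"
      by (metis mult.assoc)
  qed
  have merge: "x ^ u * (x ^ v * z) = x ^ (u + v) * z" for x z :: 'a and u v
    by (simp add: power_add mult.assoc)
  \<comment> \<open>Oriented rules that sort monomials but leave the three noncommuting pairs in place.\<close>
  note normal = mult.assoc comm[OF c1(1)] comm[OF c1(2)] comm[OF c1(3)] comm[OF c1(4)]
    comm[OF c2(1)] comm[OF c2(2)] comm[OF c53] merge power_add[symmetric]
  have "(x1 ^ j * x2 ^ k * x3 ^ l * x4 ^ m * x5 ^ n) * (x1 ^ p * x2 ^ q * x3 ^ r * x4 ^ s * x5 ^ t) =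
      x1 ^ (j + p) * x2 ^ k * x3 ^ l * x4 ^ m * (x5 ^ n * x2 ^ q) * x3 ^ r * x4 ^ s * x5 ^ t"
    by (simp add: normal)
  also have "\<dots> = (\<Sum>\<alpha> = 0..min n q. scale (A \<alpha>)
      (x1 ^ (j + p + \<alpha>) * x2 ^ (k + (q - \<alpha>)) * x3 ^ l * (x4 ^ m * x3 ^ r) * (x5 ^ (n - \<alpha>) * x4 ^ s) * x5 ^ t))"
    unfolding e52 by (simp add: sum_distrib_left sum_distrib_right scalars normal)
  also have "\<dots> = (\<Sum>\<alpha> = 0..min n q.
       \<Sum>(\<beta>1, \<beta>2) \<in> {(\<beta>1, \<beta>2). \<beta>1 + \<beta>2 \<le> s \<and> \<beta>1 + 2 * \<beta>2 \<le> n - \<alpha>}.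
         \<Sum>\<gamma> = 0..min m r. scale (A \<alpha> * B (n - \<alpha>) \<beta>1 \<beta>2 * C \<gamma>)
      (x1 ^ (j + p + \<alpha> + \<beta>2 + \<gamma>) * x2 ^ (k + (q - \<alpha>) + \<beta>1) * x3 ^ (l + (r - \<gamma>)) *
        x4 ^ ((m - \<gamma>) + (s - \<beta>1 - \<beta>2)) * x5 ^ ((n - \<alpha> - \<beta>1 - 2 * \<beta>2) + t)))"
    unfolding e43 e54
    by (simp add: sum_distrib_left sum_distrib_right scale_sum_right case_prod_unfold scalars normal ac_simps)
  also have "\<dots> = (\<Sum>\<alpha> = 0..min n q.
       \<Sum>(\<beta>1, \<beta>2) \<in> {(\<beta>1, \<beta>2). \<beta>1 + \<beta>2 \<le> s \<and> \<beta>1 + 2 * \<beta>2 \<le> n - \<alpha>}.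
         \<Sum>\<gamma> = 0..min m r.
           scale
             (of_nat (n choose \<alpha>) * of_nat (q choose \<alpha>) * of_nat (s choose (\<beta>1 + \<beta>2)) *
              of_nat ((n - \<alpha>) choose (\<beta>1 + 2 * \<beta>2)) * of_nat ((\<beta>1 + \<beta>2) choose \<beta>1) *
              of_nat (m choose \<gamma>) * of_nat (r choose \<gamma>) *
              fact \<alpha> * (fact (\<beta>1 + 2 * \<beta>2) / 2 ^ \<beta>2) * fact \<gamma> *
              (- 1) ^ (\<alpha> + \<beta>1 + \<gamma>))
             (x1 ^ (j + p + \<alpha> + \<beta>2 + \<gamma>) * x2 ^ (k + q - \<alpha> + \<beta>1) * x3 ^ (l + r - \<gamma>) *
              x4 ^ (m + s - \<gamma> - \<beta>1 - \<beta>2) * x5 ^ (n + t - \<alpha> - \<beta>1 - 2 * \<beta>2)))"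
  \<comment> \<open>The summation bounds make all truncated subtractions in the exponents exact.\<close>
  proof (intro sum.cong refl, clarify, intro sum.cong refl)
    fix \<alpha> \<beta>1 \<beta>2 \<gamma>
    assume "\<alpha> \<in> {0..min n q}" "\<beta>1 + \<beta>2 \<le> s" "\<beta>1 + 2 * \<beta>2 \<le> n - \<alpha>" "\<gamma> \<in> {0..min m r}"
    then have exps: "k + (q - \<alpha>) + \<beta>1 = k + q - \<alpha> + \<beta>1" "l + (r - \<gamma>) = l + r - \<gamma>"
      "(m - \<gamma>) + (s - \<beta>1 - \<beta>2) = m + s - \<gamma> - \<beta>1 - \<beta>2"
      "(n - \<alpha> - \<beta>1 - 2 * \<beta>2) + t = n + t - \<alpha> - \<beta>1 - 2 * \<beta>2"
      by auto
    have coeff: "A \<alpha> * B (n - \<alpha>) \<beta>1 \<beta>2 * C \<gamma> =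
      of_nat (n choose \<alpha>) * of_nat (q choose \<alpha>) * of_nat (s choose (\<beta>1 + \<beta>2)) *
              of_nat ((n - \<alpha>) choose (\<beta>1 + 2 * \<beta>2)) * of_nat ((\<beta>1 + \<beta>2) choose \<beta>1) *
              of_nat (m choose \<gamma>) * of_nat (r choose \<gamma>) *
              fact \<alpha> * (fact (\<beta>1 + 2 * \<beta>2) / 2 ^ \<beta>2) * fact \<gamma> *
              (- 1) ^ (\<alpha> + \<beta>1 + \<gamma>)"
      by (simp add: A_def B_def C_def power_add power_divide ac_simps)
    show "scale (A \<alpha> * B (n - \<alpha>) \<beta>1 \<beta>2 * C \<gamma>)
      (x1 ^ (j + p + \<alpha> + \<beta>2 + \<gamma>) * x2 ^ (k + (q - \<alpha>) + \<beta>1) * x3 ^ (l + (r - \<gamma>)) *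
        x4 ^ ((m - \<gamma>) + (s - \<beta>1 - \<beta>2)) * x5 ^ ((n - \<alpha> - \<beta>1 - 2 * \<beta>2) + t)) =
      scale
             (of_nat (n choose \<alpha>) * of_nat (q choose \<alpha>) * of_nat (s choose (\<beta>1 + \<beta>2)) *
              of_nat ((n - \<alpha>) choose (\<beta>1 + 2 * \<beta>2)) * of_nat ((\<beta>1 + \<beta>2) choose \<beta>1) *
              of_nat (m choose \<gamma>) * of_nat (r choose \<gamma>) *
              fact \<alpha> * (fact (\<beta>1 + 2 * \<beta>2) / 2 ^ \<beta>2) * fact \<gamma> *
              (- 1) ^ (\<alpha> + \<beta>1 + \<gamma>))
             (x1 ^ (j + p + \<alpha> + \<beta>2 + \<gamma>) * x2 ^ (k + q - \<alpha> + \<beta>1) * x3 ^ (l + r - \<gamma>) *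
              x4 ^ (m + s - \<gamma> - \<beta>1 - \<beta>2) * x5 ^ (n + t - \<alpha> - \<beta>1 - 2 * \<beta>2))"
      unfolding exps coeff ..
  qed
  finally show ?thesis .
qed

theorem theorem4p10:
  fixes X :: "5 \<Rightarrow> 'f::real_or_complex n54_uea"
    and j k l m n p q r s t :: nat
  defines "X \<equiv> \<lambda>i. n54_iota (n54_x i)"
  shows "(X 1 ^ j * X 2 ^ k * X 3 ^ l * X 4 ^ m * X 5 ^ n) *
         (X 1 ^ p * X 2 ^ q * X 3 ^ r * X 4 ^ s * X 5 ^ t) =
    (\<Sum>\<alpha> = 0..min n q.
       \<Sum>(\<beta>1, \<beta>2) \<in> {(\<beta>1, \<beta>2). \<beta>1 + \<beta>2 \<le> s \<and> \<beta>1 + 2 * \<beta>2 \<le> n - \<alpha>}.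
         \<Sum>\<gamma> = 0..min m r.
           n54_scale
             (of_nat (n choose \<alpha>) * of_nat (q choose \<alpha>) * of_nat (s choose (\<beta>1 + \<beta>2)) *
              of_nat ((n - \<alpha>) choose (\<beta>1 + 2 * \<beta>2)) * of_nat ((\<beta>1 + \<beta>2) choose \<beta>1) *
              of_nat (m choose \<gamma>) * of_nat (r choose \<gamma>) *
              fact \<alpha> * (fact (\<beta>1 + 2 * \<beta>2) / 2 ^ \<beta>2) * fact \<gamma> *
              (- 1) ^ (\<alpha> + \<beta>1 + \<gamma>))
             (X 1 ^ (j + p + \<alpha> + \<beta>2 + \<gamma>) * X 2 ^ (k + q - \<alpha> + \<beta>1) * X 3 ^ (l + r - \<gamma>) *
              X 4 ^ (m + s - \<gamma> - \<beta>1 - \<beta>2) * X 5 ^ (n + t - \<alpha> - \<beta>1 - 2 * \<beta>2)))"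
proof -
  interpret iota: Vector_Spaces.linear "(*s)" n54_scale "n54_iota :: 'f ^ 5 \<Rightarrow> _"
    by (rule linear_n54_iota)
  have rel: "X u * X v = X v * X u + n54_iota (n54_bracket (n54_x u) (n54_x v))" for u v
    by (simp add: X_def n54_iota_bracket)
  show ?thesis
  proof (rule n54_product_formula[OF assoc_algebra_n54])
    show "X 2 * X 1 = X 1 * X 2" "X 3 * X 1 = X 1 * X 3" "X 4 * X 1 = X 1 * X 4"
      "X 5 * X 1 = X 1 * X 5" "X 3 * X 2 = X 2 * X 3" "X 4 * X 2 = X 2 * X 4"
      "X 5 * X 3 = X 3 * X 5"
      by (subst rel, simp add: n54_bracket_basis iota.zero)+
    show "X 4 * X 3 = X 3 * X 4 - X 1" "X 5 * X 2 = X 2 * X 5 - X 1" "X 5 * X 4 = X 4 * X 5 - X 2"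
      by (subst rel, simp add: n54_bracket_basis iota.neg X_def)+
  qed
qed

end
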